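(* Let $\mathcal A$ be a unital associative algebra over $\mathbb C$ and let $L^{\pm}=(L^{\pm}_{ij})_{i,j=1,2}$ be two $2\times 2$ matrices with entries in $\mathcal A$. For $x\neq 0$ put $L(x)=x^{-1/2}L^{+}+x^{1/2}L^{-}$. Then the three relations $$R^{+}L^{+}_1L^{+}_2=L^{+}_2L^{+}_1R^{+},\qquad R^{+}L^{-}_1L^{-}_2=L^{-}_2L^{-}_1R^{+},\qquad R^{+}L^{+}_1L^{-}_2=L^{-}_2L^{+}_1R^{+}$$ all hold if and only if $$R^{+}(x/y)\,L_1(x)\,L_2(y)=L_2(y)\,L_1(x)\,R^{+}(x/y)\qquad\text{for all nonzero }x,y\in\mathbb C .$$
   Context: Let $P$ be the permutation (flip) matrix on $\mathbb C^2\otimes\mathbb C^2$, with basis ordered $e_1\otimes e_1, e_1\otimes e_2, e_2\otimes e_1, e_2\otimes e_2$. Let $$R=\frac1{\sqrt2}\begin{pmatrix}1&0&0&1\\0&1&1&0\\0&1&-1&0\\-1&0&0&1\end{pmatrix},\qquad R^{+}=PRP,\qquad R^{-}=R^{-1},$$ and $R^{+}(x)=x^{-1/2}R^{+}+x^{1/2}R^{-}$ for $x\ne0$. Here $R^+(x)=PR(x)P$ with $R(x)=x^{-1/2}R+x^{1/2}(PRP)^{-1}$. For a $2\times2$ matrix $L$ with entries in $\mathcal A$, $L_1=L\otimes \mathbf 1$ and $L_2=\mathbf 1\otimes L$ are the $4\times 4$ matrices over $\mathcal A$ with $(L_1)_{(i,k),(j,l)}=L_{ij}\delta_{kl}$ and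 $(L_2)_{(i,k),(j,l)}=\delta_{ij}L_{kl}$. Products are products of matrices over $\mathcal A$; scalar matrices such as $R^{+}$ have entries in $\mathbb C$. For given $x,y$ square roots $x^{1/2},y^{1/2}$ are chosen and $(x/y)^{1/2}=x^{1/2}/y^{1/2}$ (the choices only affect overall signs). *)

theory Defs
  imports "HOL-Analysis.Analysis"
begin

text \<open>Unital associative algebras over the complex numbers, with an explicit scalar
  multiplication. The sort \<open>{ring, monoid_mult}\<close> is used instead of \<open>ring_1\<close>
  because the latter imposes \<open>0 \<noteq> 1\<close> and so excludes the zero algebra.\<close>

locale complex_unital_algebra = vector_space smul
  for smul :: "complex \<Rightarrow> 'a::{ring, monoid_mult} \<Rightarrow> 'a" +
  assumes scale_mult_left: "smul c (a * b) = smul c a * b"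
    and scale_mult_right: "smul c (a * b) = a * smul c b"

text \<open>The product \<open>**\<close> of the library requires \<open>semiring_1\<close>, hence \<open>0 \<noteq> 1\<close>;
  this is the same formula over a weaker sort.\<close>

definition mat_prod :: "'a::semiring_0 ^ 'n ^ 'm \<Rightarrow> 'a ^ 'p ^ 'n \<Rightarrow> 'a ^ 'p ^ 'm"
    (infixl \<open>\<odot>\<close> 70) where
  "A \<odot> B = (\<chi> i j. \<Sum>k\<in>UNIV. A $ i $ k * B $ k $ j)"

definition scale_mat :: "(complex \<Rightarrow> 'a \<Rightarrow> 'a) \<Rightarrow> complex \<Rightarrow> 'a ^ 'n ^ 'm \<Rightarrow> 'a ^ 'n ^ 'm" where
  "scale_mat smul c M = (\<chi> i j. smul c (M $ i $ j))"

definition embed_mat ::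
    "(complex \<Rightarrow> 'a::{ring, monoid_mult} \<Rightarrow> 'a) \<Rightarrow> complex ^ 'n ^ 'm \<Rightarrow> 'a ^ 'n ^ 'm" where
  "embed_mat smul M = (\<chi> i j. smul (M $ i $ j) 1)"

text \<open>Operators on the tensor square of the plane are matrices indexed by pairs \<open>(i, k)\<close>,
  standing for the basis vector \<open>e\<^sub>i \<otimes> e\<^sub>k\<close>; the elements of the index type \<open>2\<close>
  are \<open>1\<close> and \<open>2\<close> (where \<open>2 = 0\<close>). The function \<open>basis_pos\<close> is the position, counted
  from \<open>0\<close>, in the order \<open>(1,1), (1,2), (2,1), (2,2)\<close>.\<close>

definition basis_pos :: "2 \<times> 2 \<Rightarrow> nat" where
  "basis_pos p = (if fst p = 1 then 0 else 2) + (if snd p = 1 then 0 else 1)"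

definition flip_mat :: "complex ^ (2 \<times> 2) ^ (2 \<times> 2)" where
  "flip_mat = (\<chi> r c. if r = prod.swap c then 1 else 0)"

definition R_mat :: "complex ^ (2 \<times> 2) ^ (2 \<times> 2)" where
  "R_mat = (\<chi> r c. complex_of_real (1 / sqrt 2) *
     ([[ 1, 0,  0, 1],
       [ 0, 1,  1, 0],
       [ 0, 1, -1, 0],
       [-1, 0,  0, 1]] ! basis_pos r ! basis_pos c))"

definition R_plus :: "complex ^ (2 \<times> 2) ^ (2 \<times> 2)" where
  "R_plus = flip_mat ** R_mat ** flip_mat"

definition R_minus :: "complex ^ (2 \<times> 2) ^ (2 \<times> 2)" where
  "R_minus = matrix_inv R_mat"

text \<open>In the spectral-parameter dependent matrices \<open>R\<^sup>+(x)\<close> and \<open>L(x)\<close> the argument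
  \<open>s\<close> is the chosen square root of \<open>x\<close>.\<close>

definition R_plus_spec :: "complex \<Rightarrow> complex ^ (2 \<times> 2) ^ (2 \<times> 2)" where
  "R_plus_spec s = scale_mat (*) (inverse s) R_plus + scale_mat (*) s R_minus"

definition L_spec ::
    "(complex \<Rightarrow> 'a::{ring, monoid_mult} \<Rightarrow> 'a) \<Rightarrow> 'a ^ 2 ^ 2 \<Rightarrow> 'a ^ 2 ^ 2 \<Rightarrow> complex \<Rightarrow> 'a ^ 2 ^ 2"
  where
  "L_spec smul Lp Lm s = scale_mat smul (inverse s) Lp + scale_mat smul s Lm"

definition leg1 :: "'a::zero ^ 2 ^ 2 \<Rightarrow> 'a ^ (2 \<times> 2) ^ (2 \<times> 2)" where
  "leg1 L = (\<chi> r c. if snd r = snd c then L $ fst r $ fst c else 0)"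

definition leg2 :: "'a::zero ^ 2 ^ 2 \<Rightarrow> 'a ^ (2 \<times> 2) ^ (2 \<times> 2)" where
  "leg2 L = (\<chi> r c. if fst r = fst c then L $ snd r $ snd c else 0)"

end

theory Submission imports Defs begin

text \<open>Write \<open>D(M, K, L) = M K\<^sub>1 L\<^sub>2 - L\<^sub>2 K\<^sub>1 M\<close>, which is trilinear. Since
  \<open>R\<^sup>+(x/y)\<close>, \<open>L(x)\<close> and \<open>L(y)\<close> are nonzero multiples of \<open>y R\<^sup>+ + x R\<^sup>-\<close>, \<open>L\<^sup>+ + x L\<^sup>-\<close> and
  \<open>L\<^sup>+ + y L\<^sup>-\<close>, the spectral relation is the vanishing of a polynomial in \<open>x, y\<close> whose
  coefficients are \<open>D(R\<^sup>\<plusminus>, L\<^sup>\<plusminus>, L\<^sup>\<plusminus>)\<close>, except that the coefficient of \<open>x y\<close> collects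
  \<open>D(R\<^sup>+, L\<^sup>-, L\<^sup>+) + D(R\<^sup>-, L\<^sup>+, L\<^sup>-)\<close>. Three of the coefficients are the relations
  in question. Conversely, conjugation by the flip \<open>P\<close> together with \<open>R\<^sup>- = R\<^sup>-\<^sup>1\<close> turns
  \<open>D(R\<^sup>+, K, L) = 0\<close> into \<open>D(R\<^sup>-, L, K) = 0\<close>, and the Hecke relation \<open>R\<^sup>+ + R\<^sup>- = \<surd>2 P\<close>
  makes the mixed coefficient vanish because \<open>D(P, K, L) + D(P, L, K) = 0\<close>.\<close>

section \<open>Polynomials with coefficients in a vector space\<close>

context vector_space
begin

lemma polynomial_eq_0_imp_coeff_eq_0:
  assumes "infinite S"
    and "\<And>x. x \<in> S \<Longrightarrow> (\<Sum>i\<le>n. scale (x ^ i) (a i)) = 0"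
    and "i \<le> n"
  shows "a i = 0"
proof -
  define B where "B = extend_basis {}"
  have independent_B: "independent B" and span_B: "span B = UNIV"
    by (simp_all add: B_def independent_extend_basis independent_empty)
  have "representation B (a i) b = 0" for b
  proof -
    interpret coordinate: Vector_Spaces.linear scale "(*)" "\<lambda>v. representation B v b"
      by (rule linear_representation[OF independent_B span_B])
    define p where "p = (\<Sum>i\<le>n. monom (representation B (a i) b) i)"
    have "poly p x = representation B (\<Sum>i\<le>n. scale (x ^ i) (a i)) b" for x
      by (simp add: p_def poly_sum poly_monom coordinate.sum coordinate.scale mult.commute)
    then have "S \<subseteq> {x. poly p x = 0}"
      using assms(2) coordinate.zero by auto
    then have "p = 0"
      using \<open>infinite S\<close> poly_roots_finite finite_subset by blast
    moreover have "coeff p i = representation B (a i) b"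
      using \<open>i \<le> n\<close> by (simp add: p_def coeff_sum)
    ultimately show ?thesis
      by simp
  qed
  then show ?thesis
    using sum_nonzero_representation_eq[OF independent_B, of "a i"] by (simp add: span_B)
qed

lemma bivariate_polynomial_eq_0_iff:
  assumes "infinite S" "infinite T"
  shows "(\<forall>x\<in>S. \<forall>y\<in>T. (\<Sum>i\<le>m. \<Sum>j\<le>n. scale (x ^ i * y ^ j) (a i j)) = 0)
    \<longleftrightarrow> (\<forall>i\<le>m. \<forall>j\<le>n. a i j = 0)" (is "?vanishes \<longleftrightarrow> ?coeffs_vanish")
proof
  assume ?vanishes
  then have "(\<Sum>i\<le>m. scale (x ^ i) (\<Sum>j\<le>n. scale (y ^ j) (a i j))) = 0"
    if "x \<in> S" "y \<in> T" for x y
    using that by (simp add: scale_sum_right)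
  then have "(\<Sum>j\<le>n. scale (y ^ j) (a i j)) = 0" if "i \<le> m" "y \<in> T" for i y
    using polynomial_eq_0_imp_coeff_eq_0[OF \<open>infinite S\<close>,
        where a = "\<lambda>i. \<Sum>j\<le>n. scale (y ^ j) (a i j)"] that by blast
  then show ?coeffs_vanish
    using polynomial_eq_0_imp_coeff_eq_0[OF \<open>infinite T\<close>, where a = "a _"] by blast
qed simp

end

section \<open>Matrices over a complex algebra\<close>

lemma mat_prod_assoc: "(A \<odot> B) \<odot> C = A \<odot> (B \<odot> C)"
proof -
  have "(\<Sum>k\<in>UNIV. (\<Sum>l\<in>UNIV. A $ i $ l * B $ l $ k) * C $ k $ j)
      = (\<Sum>l\<in>UNIV. A $ i $ l * (\<Sum>k\<in>UNIV. B $ l $ k * C $ k $ j))" for i j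
    by (simp add: sum_distrib_left sum_distrib_right mult.assoc) (rule sum.swap)
  then show ?thesis
    by (simp add: mat_prod_def)
qed

lemma mat_prod_add_left: "(A + B) \<odot> C = A \<odot> C + B \<odot> C"
  by (simp add: mat_prod_def vec_eq_iff distrib_right sum.distrib)

lemma mat_prod_add_right: "A \<odot> (B + C) = A \<odot> B + A \<odot> C"
  by (simp add: mat_prod_def vec_eq_iff distrib_left sum.distrib)

lemma leg1_add: "leg1 (A + B :: 'a::monoid_add ^ 2 ^ 2) = leg1 A + leg1 B"
  by (simp add: leg1_def vec_eq_iff)

lemma leg2_add: "leg2 (A + B :: 'a::monoid_add ^ 2 ^ 2) = leg2 A + leg2 B"
  by (simp add: leg2_def vec_eq_iff)

context complex_unital_algebra
begin

lemma vector_space_scale_mat: "vector_space (scale_mat smul)"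
  by unfold_locales
    (simp_all add: scale_mat_def vec_eq_iff scale_right_distrib scale_left_distrib)

sublocale tensor_square: vector_space "scale_mat smul :: complex \<Rightarrow> 'a ^ (2 \<times> 2) ^ (2 \<times> 2) \<Rightarrow> _"
  by (rule vector_space_scale_mat)

lemma mat_prod_scale_left: "scale_mat smul c A \<odot> B = scale_mat smul c (A \<odot> B)"
  by (simp add: mat_prod_def scale_mat_def vec_eq_iff scale_sum_right scale_mult_left)

lemma mat_prod_scale_right: "A \<odot> scale_mat smul c B = scale_mat smul c (A \<odot> B)"
  by (simp add: mat_prod_def scale_mat_def vec_eq_iff scale_sum_right scale_mult_right)

lemma leg1_scale: "leg1 (scale_mat smul c A) = scale_mat smul c (leg1 A)"
  by (simp add: leg1_def scale_mat_def vec_eq_iff)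

lemma leg2_scale: "leg2 (scale_mat smul c A) = scale_mat smul c (leg2 A)"
  by (simp add: leg2_def scale_mat_def vec_eq_iff)

lemma embed_mat_add: "embed_mat smul (A + B) = embed_mat smul A + embed_mat smul B"
  by (simp add: embed_mat_def vec_eq_iff scale_left_distrib)

lemma embed_mat_scale: "embed_mat smul (scale_mat (*) c A) = scale_mat smul c (embed_mat smul A)"
  by (simp add: embed_mat_def scale_mat_def vec_eq_iff)

lemma embed_mat_mult: "embed_mat smul (A ** B) = embed_mat smul A \<odot> embed_mat smul B"
  by (simp add: embed_mat_def mat_prod_def matrix_matrix_mult_def vec_eq_iff scale_sum_left
      flip: scale_mult_left)

lemma embed_mat_one_left: "embed_mat smul (mat 1) \<odot> A = A"
proof -
  have "smul (if i = k then 1 else 0) 1 * A $ k $ j = (if i = k then A $ k $ j else 0)" for i j k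
    by (simp flip: scale_mult_left)
  then show ?thesis
    by (simp add: embed_mat_def mat_prod_def mat_def vec_eq_iff)
qed

lemma embed_mat_one_right: "A \<odot> embed_mat smul (mat 1) = A"
proof -
  have "A $ i $ k * smul (if k = j then 1 else 0) 1 = (if k = j then A $ i $ k else 0)" for i j k
    by (simp flip: scale_mult_right)
  then show ?thesis
    by (simp add: embed_mat_def mat_prod_def mat_def vec_eq_iff)
qed

lemma embed_mat_intertwines_inverse:
  fixes A B :: "complex ^ 'n ^ 'n" and X Y :: "'a ^ 'n ^ 'n"
  assumes "A ** B = mat 1"
    and intertwines: "embed_mat smul A \<odot> X = Y \<odot> embed_mat smul A"
  shows "embed_mat smul B \<odot> Y = X \<odot> embed_mat smul B"
proof -
  have "B ** A = mat 1"
    using assms(1) by (simp add: matrix_left_right_inverse)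
  have "embed_mat smul B \<odot> Y = embed_mat smul B \<odot> Y \<odot> embed_mat smul (A ** B)"
    by (simp add: assms(1) embed_mat_one_right)
  also have "\<dots> = embed_mat smul B \<odot> (Y \<odot> embed_mat smul A) \<odot> embed_mat smul B"
    by (simp add: embed_mat_mult mat_prod_assoc)
  also have "\<dots> = embed_mat smul (B ** A) \<odot> X \<odot> embed_mat smul B"
    by (simp add: embed_mat_mult mat_prod_assoc flip: intertwines)
  also have "\<dots> = X \<odot> embed_mat smul B"
    by (simp add: \<open>B ** A = mat 1\<close> embed_mat_one_left)
  finally show ?thesis .
qed

end

section \<open>The defect of an RLL relation\<close>

definition RLL_defect ::
    "'a::ring ^ (2 \<times> 2) ^ (2 \<times> 2) \<Rightarrow> 'a ^ 2 ^ 2 \<Rightarrow> 'a ^ 2 ^ 2 \<Rightarrow> 'a ^ (2 \<times> 2) ^ (2 \<times> 2)" where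
  "RLL_defect M K L = M \<odot> leg1 K \<odot> leg2 L - leg2 L \<odot> leg1 K \<odot> M"

lemma RLL_defect_eq_0_iff:
  "RLL_defect M K L = 0 \<longleftrightarrow> M \<odot> leg1 K \<odot> leg2 L = leg2 L \<odot> leg1 K \<odot> M"
  by (simp add: RLL_defect_def)

lemma RLL_defect_add:
  "RLL_defect (M + N) K L = RLL_defect M K L + RLL_defect N K L"
  "RLL_defect M (K + K') L = RLL_defect M K L + RLL_defect M K' L"
  "RLL_defect M K (L + L') = RLL_defect M K L + RLL_defect M K L'"
  by (simp_all add: RLL_defect_def leg1_add leg2_add mat_prod_add_left mat_prod_add_right)

lemma (in complex_unital_algebra) RLL_defect_scale:
  "RLL_defect (scale_mat smul c M) K L = scale_mat smul c (RLL_defect M K L)"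
  "RLL_defect M (scale_mat smul c K) L = scale_mat smul c (RLL_defect M K L)"
  "RLL_defect M K (scale_mat smul c L) = scale_mat smul c (RLL_defect M K L)"
  by (simp_all add: RLL_defect_def leg1_scale leg2_scale mat_prod_scale_left
      mat_prod_scale_right tensor_square.scale_right_diff_distrib)

definition RLL_pencil_coeff ::
    "'a::ring ^ (2 \<times> 2) ^ (2 \<times> 2) \<Rightarrow> 'a ^ (2 \<times> 2) ^ (2 \<times> 2) \<Rightarrow> 'a ^ 2 ^ 2 \<Rightarrow> 'a ^ 2 ^ 2 \<Rightarrow>
      nat \<Rightarrow> nat \<Rightarrow> 'a ^ (2 \<times> 2) ^ (2 \<times> 2)" where
  "RLL_pencil_coeff A B K L i j =
    [[0,                RLL_defect A K K,                    RLL_defect A K L],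
     [RLL_defect B K K, RLL_defect A L K + RLL_defect B K L, RLL_defect A L L],
     [RLL_defect B L K, RLL_defect B L L,                    0]] ! i ! j"

lemma (in complex_unital_algebra) RLL_defect_pencil:
  "RLL_defect (scale_mat smul y A + scale_mat smul x B)
      (K + scale_mat smul x L) (K + scale_mat smul y L)
    = (\<Sum>i\<le>2. \<Sum>j\<le>2. scale_mat smul (x ^ i * y ^ j) (RLL_pencil_coeff A B K L i j))"
  by (simp add: RLL_pencil_coeff_def RLL_defect_add RLL_defect_scale numeral_2_eq_2 algebra_simps)

lemma all_le_2_iff: "(\<forall>i\<le>2. Q i) \<longleftrightarrow> Q 0 \<and> Q 1 \<and> Q (2::nat)"
  by (auto simp: le_Suc_eq numeral_2_eq_2)

lemma RLL_pencil_coeffs_eq_0_iff: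
  "(\<forall>i\<le>2. \<forall>j\<le>2. RLL_pencil_coeff A B K L i j = 0) \<longleftrightarrow>
    RLL_defect A K K = 0 \<and> RLL_defect A K L = 0 \<and> RLL_defect A L L = 0 \<and>
    RLL_defect B K K = 0 \<and> RLL_defect B L K = 0 \<and> RLL_defect B L L = 0 \<and>
    RLL_defect A L K + RLL_defect B K L = 0"
  by (auto simp: RLL_pencil_coeff_def all_le_2_iff)

section \<open>The flip\<close>

lemma eq_swap_iff: "p = prod.swap q \<longleftrightarrow> q = prod.swap p"
  by (metis swap_swap)

lemma flip_mat_mult_nth: "(flip_mat ** A) $ r $ c = A $ prod.swap r $ c"
  by (simp add: flip_mat_def matrix_matrix_mult_def eq_swap_iff[of r] if_distrib[of "\<lambda>u. u * _"]
      cong: if_cong)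

lemma mult_flip_mat_nth: "(A ** flip_mat) $ r $ c = A $ r $ prod.swap c"
  by (simp add: flip_mat_def matrix_matrix_mult_def if_distrib[of "(*) _"] cong: if_cong)

context complex_unital_algebra
begin

lemma embed_flip_mat_prod_nth: "(embed_mat smul flip_mat \<odot> A) $ r $ c = A $ prod.swap r $ c"
  by (simp add: flip_mat_def embed_mat_def mat_prod_def eq_swap_iff[of r]
      if_distrib[of "\<lambda>u. smul u _"] if_distrib[of "\<lambda>u. u * _"] cong: if_cong)

lemma mat_prod_embed_flip_nth: "(A \<odot> embed_mat smul flip_mat) $ r $ c = A $ r $ prod.swap c"
  by (simp add: flip_mat_def embed_mat_def mat_prod_def
      if_distrib[of "\<lambda>u. smul u _"] if_distrib[of "(*) _"] cong: if_cong)

lemma leg1_flip: "leg1 L \<odot> embed_mat smul flip_mat = embed_mat smul flip_mat \<odot> leg2 L"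
  by (simp add: vec_eq_iff embed_flip_mat_prod_nth mat_prod_embed_flip_nth leg1_def leg2_def)

lemma leg2_flip: "leg2 L \<odot> embed_mat smul flip_mat = embed_mat smul flip_mat \<odot> leg1 L"
  by (simp add: vec_eq_iff embed_flip_mat_prod_nth mat_prod_embed_flip_nth leg1_def leg2_def)

lemma legs_flip:
  "leg1 K \<odot> leg2 L \<odot> embed_mat smul flip_mat = embed_mat smul flip_mat \<odot> leg2 K \<odot> leg1 L"
  "leg2 L \<odot> leg1 K \<odot> embed_mat smul flip_mat = embed_mat smul flip_mat \<odot> leg1 L \<odot> leg2 K"
  by (simp_all only: mat_prod_assoc leg1_flip leg2_flip)
    (simp_all only: leg1_flip leg2_flip flip: mat_prod_assoc)

lemma RLL_defect_flip:
  "RLL_defect (embed_mat smul flip_mat) K L + RLL_defect (embed_mat smul flip_mat) L K = 0"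
  by (simp add: RLL_defect_def legs_flip)

lemma RLL_relation_conj_flip:
  assumes "RLL_defect (embed_mat smul M) K L = 0"
  shows "embed_mat smul (flip_mat ** M ** flip_mat) \<odot> (leg2 K \<odot> leg1 L)
    = (leg1 L \<odot> leg2 K) \<odot> embed_mat smul (flip_mat ** M ** flip_mat)"
proof -
  let ?P = "embed_mat smul flip_mat" and ?M = "embed_mat smul M"
  have "?P \<odot> ?M \<odot> ?P \<odot> (leg2 K \<odot> leg1 L) = ?P \<odot> ?M \<odot> (leg1 K \<odot> leg2 L \<odot> ?P)"
    by (simp only: legs_flip) (simp only: mat_prod_assoc)
  also have "\<dots> = ?P \<odot> (?M \<odot> leg1 K \<odot> leg2 L) \<odot> ?P"
    by (simp only: mat_prod_assoc)
  also have "\<dots> = ?P \<odot> (leg2 L \<odot> leg1 K \<odot> ?M) \<odot> ?P"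
    using assms by (simp only: RLL_defect_eq_0_iff)
  also have "\<dots> = (?P \<odot> leg2 L \<odot> leg1 K) \<odot> ?M \<odot> ?P"
    by (simp only: mat_prod_assoc)
  also have "\<dots> = (leg1 L \<odot> leg2 K) \<odot> (?P \<odot> ?M \<odot> ?P)"
    by (simp only: legs_flip(1)[symmetric]) (simp only: mat_prod_assoc)
  finally show ?thesis
    by (simp only: embed_mat_mult)
qed

lemma RLL_defect_inverse_flip:
  assumes "(flip_mat ** M ** flip_mat) ** N = mat 1"
    and "RLL_defect (embed_mat smul M) K L = 0"
  shows "RLL_defect (embed_mat smul N) L K = 0"
  using embed_mat_intertwines_inverse[OF assms(1) RLL_relation_conj_flip[OF assms(2)]]
  by (simp add: RLL_defect_eq_0_iff mat_prod_assoc)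

end

section \<open>The matrix R and its Hecke relation\<close>

lemma matrix_inv_unique:
  fixes A B :: "'a::field ^ 'n ^ 'n"
  assumes "A ** B = mat 1"
  shows "matrix_inv A = B"
proof -
  have "A ** matrix_inv A = mat 1 \<and> matrix_inv A ** A = mat 1"
    unfolding matrix_inv_def
    by (rule someI[of _ B]) (use assms matrix_left_right_inverse in auto)
  then show ?thesis
    using assms by (metis matrix_mul_assoc matrix_mul_lid matrix_mul_rid)
qed

lemma sum_UNIV_prod:
  "(\<Sum>p\<in>UNIV. f p) = (\<Sum>i\<in>UNIV. \<Sum>j\<in>UNIV. f (i :: 'a::finite, j :: 'b::finite))"
  by (simp add: sum.cartesian_product)

lemma of_real_sqrt_2_squared: "complex_of_real (sqrt 2) * complex_of_real (sqrt 2) = 2"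
  by (simp flip: of_real_mult)

lemma R_mat_mult_transpose: "R_mat ** transpose R_mat = mat 1"
  by (simp add: of_real_sqrt_2_squared R_mat_def matrix_matrix_mult_def transpose_def mat_def
      vec_eq_iff forall_2 basis_pos_def sum_UNIV_prod sum_2)

lemma R_minus_eq_transpose: "R_minus = transpose R_mat"
  unfolding R_minus_def by (rule matrix_inv_unique) (rule R_mat_mult_transpose)

lemma R_plus_nth: "R_plus $ r $ c = R_mat $ prod.swap r $ prod.swap c"
  by (simp add: R_plus_def flip_mat_mult_nth mult_flip_mat_nth)

lemma hecke_relation: "R_plus + R_minus = scale_mat (*) (complex_of_real (sqrt 2)) flip_mat"
  by (simp add: R_plus_nth R_minus_eq_transpose R_mat_def transpose_def flip_mat_def scale_mat_def
      vec_eq_iff forall_2 basis_pos_def divide_eq_eq of_real_sqrt_2_squared)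

lemma flip_R_plus_flip_mult_R_minus: "(flip_mat ** R_plus ** flip_mat) ** R_minus = mat 1"
proof -
  have "flip_mat ** R_plus ** flip_mat = R_mat"
    by (simp add: vec_eq_iff R_plus_nth flip_mat_mult_nth mult_flip_mat_nth)
  then show ?thesis
    by (simp add: R_minus_eq_transpose R_mat_mult_transpose)
qed

context complex_unital_algebra
begin

lemma RLL_defect_R_minus:
  "RLL_defect (embed_mat smul R_plus) K L = 0 \<Longrightarrow> RLL_defect (embed_mat smul R_minus) L K = 0"
  by (rule RLL_defect_inverse_flip[OF flip_R_plus_flip_mult_R_minus])

lemma RLL_defect_hecke:
  fixes K L :: "'a ^ 2 ^ 2"
  defines "Rp \<equiv> embed_mat smul R_plus" and "Rm \<equiv> embed_mat smul R_minus"
  shows "(RLL_defect Rp K L + RLL_defect Rm K L) + (RLL_defect Rp L K + RLL_defect Rm L K) = 0"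
proof -
  have "RLL_defect Rp K L + RLL_defect Rm K L = scale_mat smul (complex_of_real (sqrt 2))
      (RLL_defect (embed_mat smul flip_mat) K L)" for K L
    by (simp add: Rp_def Rm_def hecke_relation embed_mat_scale RLL_defect_scale
        flip: RLL_defect_add embed_mat_add)
  then show ?thesis
    by (simp add: RLL_defect_flip flip: tensor_square.scale_right_distrib)
qed

lemma RLL_pencil_coeffs_R_eq_0_iff:
  fixes K L :: "'a ^ 2 ^ 2"
  defines "Rp \<equiv> embed_mat smul R_plus" and "Rm \<equiv> embed_mat smul R_minus"
  shows "(\<forall>i\<le>2. \<forall>j\<le>2. RLL_pencil_coeff Rp Rm K L i j = 0) \<longleftrightarrow>
    RLL_defect Rp K K = 0 \<and> RLL_defect Rp L L = 0 \<and> RLL_defect Rp K L = 0"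
proof -
  have "RLL_defect Rp L K + RLL_defect Rm K L = 0"
    if "RLL_defect Rp K L = 0" "RLL_defect Rm L K = 0"
    using RLL_defect_hecke[of K L] that by (simp add: Rp_def Rm_def add.commute)
  then show ?thesis
    unfolding RLL_pencil_coeffs_eq_0_iff
    using RLL_defect_R_minus[folded Rp_def Rm_def] by blast
qed

lemma embed_R_plus_spec_div:
  assumes "s \<noteq> 0" "t \<noteq> 0"
  shows "embed_mat smul (R_plus_spec (s / t)) = scale_mat smul (inverse (s * t))
    (scale_mat smul (t\<^sup>2) (embed_mat smul R_plus) + scale_mat smul (s\<^sup>2) (embed_mat smul R_minus))"
  using assms
  by (simp add: R_plus_spec_def embed_mat_add embed_mat_scale tensor_square.scale_right_distrib
      field_simps power2_eq_square)

lemma L_spec_eq_scale: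
  assumes "s \<noteq> 0"
  shows "L_spec smul Lp Lm s = scale_mat smul (inverse s) (Lp + scale_mat smul (s\<^sup>2) Lm)"
  using assms
  by (simp add: L_spec_def scale_mat_def vec_eq_iff scale_right_distrib power2_eq_square)

lemma RLL_defect_spec_eq_0_iff:
  assumes "s \<noteq> 0" "t \<noteq> 0"
  shows "RLL_defect (embed_mat smul (R_plus_spec (s / t))) (L_spec smul Lp Lm s)
      (L_spec smul Lp Lm t) = 0 \<longleftrightarrow>
    (\<Sum>i\<le>2. \<Sum>j\<le>2. scale_mat smul ((s\<^sup>2) ^ i * (t\<^sup>2) ^ j)
      (RLL_pencil_coeff (embed_mat smul R_plus) (embed_mat smul R_minus) Lp Lm i j)) = 0"
  using assms
  by (simp add: embed_R_plus_spec_div L_spec_eq_scale RLL_defect_scale flip: RLL_defect_pencil)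

end

theorem mainTheorem1:
  fixes smul :: "complex \<Rightarrow> 'a::{ring, monoid_mult} \<Rightarrow> 'a"
    and Lp Lm :: "'a ^ 2 ^ 2"
    and rt :: "complex \<Rightarrow> complex"
  assumes "complex_unital_algebra smul"
    and "\<And>x. x \<noteq> 0 \<Longrightarrow> (rt x)\<^sup>2 = x"
  shows "(embed_mat smul R_plus \<odot> leg1 Lp \<odot> leg2 Lp = leg2 Lp \<odot> leg1 Lp \<odot> embed_mat smul R_plus \<and>
          embed_mat smul R_plus \<odot> leg1 Lm \<odot> leg2 Lm = leg2 Lm \<odot> leg1 Lm \<odot> embed_mat smul R_plus \<and>
          embed_mat smul R_plus \<odot> leg1 Lp \<odot> leg2 Lm = leg2 Lm \<odot> leg1 Lp \<odot> embed_mat smul R_plus)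
     \<longleftrightarrow>
         (\<forall>x y. x \<noteq> 0 \<longrightarrow> y \<noteq> 0 \<longrightarrow>
            embed_mat smul (R_plus_spec (rt x / rt y)) \<odot> leg1 (L_spec smul Lp Lm (rt x))
              \<odot> leg2 (L_spec smul Lp Lm (rt y))
          = leg2 (L_spec smul Lp Lm (rt y)) \<odot> leg1 (L_spec smul Lp Lm (rt x))
              \<odot> embed_mat smul (R_plus_spec (rt x / rt y)))"
proof -
  interpret complex_unital_algebra smul by fact
  let ?Rp = "embed_mat smul R_plus" and ?Rm = "embed_mat smul R_minus"
  let ?spectral_defect = "\<lambda>x y. RLL_defect (embed_mat smul (R_plus_spec (rt x / rt y)))
    (L_spec smul Lp Lm (rt x)) (L_spec smul Lp Lm (rt y))"
  let ?polynomial = "\<lambda>x y. \<Sum>i\<le>2. \<Sum>j\<le>2. scale_mat smul (x ^ i * y ^ j)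
    (RLL_pencil_coeff ?Rp ?Rm Lp Lm i j)"
  have infinite_nonzero: "infinite (- {0::complex})"
    by (simp add: infinite_UNIV_char_0 Compl_eq_Diff_UNIV)
  have rt_nonzero: "rt x \<noteq> 0" if "x \<noteq> 0" for x
    using assms(2)[OF that] that by auto
  have "?spectral_defect x y = 0 \<longleftrightarrow> ?polynomial x y = 0" if "x \<noteq> 0" "y \<noteq> 0" for x y
    using RLL_defect_spec_eq_0_iff[OF rt_nonzero[OF that(1)] rt_nonzero[OF that(2)]]
    by (simp only: assms(2)[OF that(1)] assms(2)[OF that(2)])
  then have "(\<forall>x y. x \<noteq> 0 \<longrightarrow> y \<noteq> 0 \<longrightarrow> ?spectral_defect x y = 0) \<longleftrightarrow>
      (\<forall>x\<in>-{0}. \<forall>y\<in>-{0}. ?polynomial x y = 0)"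
    by blast
  also have "\<dots> \<longleftrightarrow> (\<forall>i\<le>2. \<forall>j\<le>2. RLL_pencil_coeff ?Rp ?Rm Lp Lm i j = 0)"
    by (rule tensor_square.bivariate_polynomial_eq_0_iff[OF infinite_nonzero infinite_nonzero])
  also have "\<dots> \<longleftrightarrow> RLL_defect ?Rp Lp Lp = 0 \<and> RLL_defect ?Rp Lm Lm = 0 \<and> RLL_defect ?Rp Lp Lm = 0"
    by (rule RLL_pencil_coeffs_R_eq_0_iff)
  finally show ?thesis
    unfolding RLL_defect_eq_0_iff by (rule sym)
qed

end
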